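(* Let $S$ be a finite totally ordered set, let $d\ge 1$ and $N\geq 2$ be integers, and let $(P^i)_{1\leq i\leq N}$ be an $N$-tuple of PCA dynamics on $S^{\mathbb{Z}^d}$. There exists an increasing synchronous coupling $Q$ of $(P^1,\dots,P^N)$ if and only if the $N$-tuple $(P^1,\dots,P^N)$ is increasing.
   Context: Let $S$ be a finite set with a partial order $\preceq$ (total in the claim). A PCA (probabilistic cellular automaton) dynamics on $S^{\mathbb{Z}^d}$ is a time-homogeneous discrete-time Markov chain on $S^{\mathbb{Z}^d}$ with transition kernel of product form $P(d\sigma\mid\eta)=\bigotimes_{k\in\mathbb{Z}^d}p_k(d\sigma_k\mid\eta)$, where for each site $k$ and each $\eta\in S^{\mathbb{Z}^d}$, $p_k(\cdot\mid\eta)$ is a probability measure on $S$; all PCA are assumed local: for every $k$ there is a finite $V_k\subset\mathbb{Z}^d$ such that $p_k(\cdot\mid\eta)$ depends on $\eta$ only through $(\eta_j)_{j\in V_k}$. One writes $P=\bigotimes_k p_k$ and $P^i=\bigotimes_k p^i_k$. Order: configurations satisfy $\sigma\preceq\eta$ iff $\sigma_k\preceq\eta_k$ for all $k$. A real function $f$ is increasing if $\sigma\preceq\eta\Rightarrow f(\sigma)\le f(\eta)$. For probability measures, $\nu_1\preceq\nu_2$ means $\int f\,d\nu_1\le\int f\,d\nu_2$ for all increasing (bounded measurable) $f$; the same definition applies to measures on $S$. Increasing $N$-tuple: $(P^1,\dots,P^N)$ is increasing if for all $\zeta^1\preceq\zeta^2\preceq\cdots\preceq\zeta^N$ in $S^{\mathbb{Z}^d}$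 one has $P^1(\cdot\mid\zeta^1)\preceq P^2(\cdot\mid\zeta^2)\preceq\cdots\preceq P^N(\cdot\mid\zeta^N)$. Synchronous coupling of $(P^i)_{1\le i\le N}$: a Markovian dynamics $Q$ on $(S^{\mathbb{Z}^d})^N$ which is itself a (local) PCA dynamics (with spin space $S^N$), $Q=\bigotimes_{k}q_k$, whose marginals are $P^1,\dots,P^N$, i.e. for all $k\in\mathbb{Z}^d$, all $i$, all $s^i\in S$ and all $\zeta^1,\dots,\zeta^N\in S^{\mathbb{Z}^d}$, $p^i_k(s^i\mid\zeta^i)=\sum_{s^j\in S,\,j\ne i}q_k\big((s^1,\dots,s^N)\mid(\zeta^1,\dots,\zeta^N)\big)$. Increasing synchronous coupling: a synchronous coupling $Q$ such that for all initial configurations $\sigma^1\preceq\cdots\preceq\sigma^N$ and all times $n\ge1$, $Q\big(\omega^1(n)\preceq\cdots\preceq\omega^N(n)\mid(\omega^1,\dots,\omega^N)(0)=(\sigma^1,\dots,\sigma^N)\big)=1$, where $(\omega^1,\dots,\omega^N)(n)$ is the state at time $n$. *)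

theory Defs
  imports "HOL-Probability.Probability"
begin

text \<open>
  The lattice \<open>\<int>\<^sup>d\<close> is \<^typ>\<open>int ^ 'd\<close>.  A PCA dynamics is given by its family
  of local kernels \<open>p k \<eta> = p\<^sub>k(\<cdot> | \<eta>)\<close>; the transition kernel on configurations is their
  product \<open>pca_kernel p\<close>.
\<close>

type_synonym ('d, 's) config = "int ^ 'd \<Rightarrow> 's"

type_synonym ('d, 's) local_kernels = "int ^ 'd \<Rightarrow> ('d, 's) config \<Rightarrow> 's pmf"

definition is_pca :: "('d::finite, 's) local_kernels \<Rightarrow> bool" where
  "is_pca p \<longleftrightarrow>
     (\<forall>k. \<exists>V. finite V \<and> (\<forall>\<eta> \<eta>'. (\<forall>j\<in>V. \<eta> j = \<eta>' j) \<longrightarrow> p k \<eta> = p k \<eta>'))"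

definition pca_kernel ::
    "('d::finite, 's) local_kernels \<Rightarrow> ('d, 's) config \<Rightarrow> ('d, 's) config measure" where
  "pca_kernel p \<eta> = (\<Pi>\<^sub>M k\<in>UNIV. measure_pmf (p k \<eta>))"

definition config_space :: "('d::finite, 's) config measure" where
  "config_space = (\<Pi>\<^sub>M k\<in>UNIV. count_space UNIV)"

text \<open>Law of the state at time \<open>n\<close> of the Markov chain started at \<open>\<eta>\<close>.\<close>

primrec pca_law ::
    "('d::finite, 's) local_kernels \<Rightarrow> nat \<Rightarrow> ('d, 's) config \<Rightarrow> ('d, 's) config measure" where
  "pca_law p 0 \<eta> = return config_space \<eta>"
| "pca_law p (Suc n) \<eta> = pca_law p n \<eta> \<bind> pca_kernel p"

text \<open>
  On configurations \<^const>\<open>less_eq\<close> is the sitewise order, so \<^const>\<open>mono\<close> is the notion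
  of an increasing function.
\<close>

definition stoch_le :: "'a::order measure \<Rightarrow> 'a measure \<Rightarrow> bool" where
  "stoch_le \<mu> \<nu> \<longleftrightarrow> sets \<mu> = sets \<nu> \<and>
     (\<forall>f :: 'a \<Rightarrow> real. f \<in> borel_measurable \<mu> \<longrightarrow> bounded (range f) \<longrightarrow> mono f \<longrightarrow>
        integral\<^sup>L \<mu> f \<le> integral\<^sup>L \<nu> f)"

text \<open>
  An \<open>N\<close>-tuple is a family over a finite linearly ordered index type \<open>'n\<close> with
  \<open>N = CARD('n)\<close>; the chain \<open>\<zeta>\<^sup>1 \<preceq> \<dots> \<preceq> \<zeta>\<^sup>N\<close> is \<open>mono \<zeta>\<close>.
\<close>

definition increasing_tuple ::
    "('n::{finite,linorder} \<Rightarrow> ('d::finite, 's::order) local_kernels) \<Rightarrow> bool" where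
  "increasing_tuple P \<longleftrightarrow>
     (\<forall>\<zeta> :: 'n \<Rightarrow> ('d, 's) config. mono \<zeta> \<longrightarrow>
        (\<forall>i j. i \<le> j \<longrightarrow> stoch_le (pca_kernel (P i) (\<zeta> i)) (pca_kernel (P j) (\<zeta> j))))"

text \<open>The identification of \<open>(S\<^bsup>\<int>^d\<^esup>)\<^sup>N\<close> with \<open>(S\<^sup>N)\<^bsup>\<int>^d\<^esup>\<close>, and its inverse.\<close>

definition join_configs :: "('n \<Rightarrow> ('d::finite, 's) config) \<Rightarrow> ('d, 'n \<Rightarrow> 's) config" where
  "join_configs \<zeta> = (\<lambda>k i. \<zeta> i k)"

definition split_config :: "('d::finite, 'n \<Rightarrow> 's) config \<Rightarrow> 'n \<Rightarrow> ('d, 's) config" where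
  "split_config \<omega> = (\<lambda>i k. \<omega> k i)"

definition synchronous_coupling ::
    "('n::finite \<Rightarrow> ('d::finite, 's::finite) local_kernels) \<Rightarrow>
     ('d, 'n \<Rightarrow> 's) local_kernels \<Rightarrow> bool" where
  "synchronous_coupling P Q \<longleftrightarrow> is_pca Q \<and>
     (\<forall>k i s \<zeta>. pmf (P i k (\<zeta> i)) s = (\<Sum>t | t i = s. pmf (Q k (join_configs \<zeta>)) t))"

definition increasing_synchronous_coupling ::
    "('n::{finite,linorder} \<Rightarrow> ('d::finite, 's::{finite,order}) local_kernels) \<Rightarrow>
     ('d, 'n \<Rightarrow> 's) local_kernels \<Rightarrow> bool" where
  "increasing_synchronous_coupling P Q \<longleftrightarrow> synchronous_coupling P Q \<and>
     (\<forall>\<sigma> n. mono \<sigma> \<longrightarrow> n \<ge> 1 \<longrightarrow>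
        measure (pca_law Q n (join_configs \<sigma>)) {\<omega>. mono (split_config \<omega>)} = 1)"

end

theory Submission
  imports Defs
begin

text \<open>
  On a finite chain the stochastic order means that the distribution functions are ordered
  pointwise, so feeding one uniform variable into all \<open>N\<close> quantile functions at a site couples
  the local kernels monotonically, as soon as the present configurations are ordered.  Doing this
  independently at every site is a local PCA, and it preserves the order at each step.
  Conversely, the time-one law of an increasing coupling started at \<open>\<zeta>\<close> has the measures
  \<open>P\<^sup>i(\<cdot> | \<zeta>\<^sup>i)\<close> as marginals and is concentrated on ordered tuples.
\<close>

section \<open>Quantile functions on a finite chain\<close>

text \<open>
  For \<open>u > 1\<close> the minimum is over the empty set; only \<open>u \<in> {0<..1}\<close> is used.
\<close>

definition quantile :: "'s::{finite,linorder} pmf \<Rightarrow> real \<Rightarrow> 's" where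
  "quantile p u = Min {s. u \<le> measure p {..s}}"

lemma upper_set_nonempty:
  fixes p :: "'s::{finite,linorder} pmf"
  assumes "u \<le> 1"
  shows "{s. u \<le> measure p {..s}} \<noteq> {}"
proof -
  have "{..Max (UNIV :: 's set)} = UNIV" by auto
  then have "measure p {..Max (UNIV :: 's set)} = 1" by simp
  with assms show ?thesis by (auto intro!: exI[of _ "Max UNIV"])
qed

text \<open>The set whose minimum defines the quantile is upward closed, since distribution
  functions increase. The minimum is therefore at most \<open>s\<close> exactly when
  \<open>s\<close> itself belongs to the set.\<close>

lemma quantile_le_iff:
  assumes "u \<le> 1"
  shows "quantile p u \<le> s \<longleftrightarrow> u \<le> measure p {..s}"
proof -
  have "u \<le> measure p {..s}" if "u \<le> measure p {..r}" "r \<le> s" for r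
    using that measure_pmf.finite_measure_mono[of "{..r}" "{..s}" p] by auto
  then show ?thesis
    unfolding quantile_def Min_le_iff[OF finite upper_set_nonempty[OF assms]] by blast
qed

lemma quantile_less_iff:
  fixes s :: "'s::{finite,linorder}"
  assumes "0 < u" "u \<le> 1"
  shows "quantile p u < s \<longleftrightarrow> u \<le> measure p {..<s}"
\<comment> \<open>At the bottom element both sides are false, and this is where \<open>0 < u\<close>
  enters. Otherwise \<open>s\<close> has an immediate predecessor \<open>r\<close>, and being below
  \<open>s\<close> means being at most \<open>r\<close>.\<close>
proof (cases "{..<s} = {}")
  case True
  then have "\<not> quantile p u < s" by (auto simp: set_eq_iff)
  then show ?thesis using assms by (simp add: True)
next
  case False
  define r where "r = Max {..<s}"
  have eq: "t < s \<longleftrightarrow> t \<le> r" for t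
    using Max_in[OF _ False] Max_ge[of "{..<s}"] unfolding r_def by (auto intro: le_less_trans)
  then have "{..<s} = {..r}" by auto
  then show ?thesis using quantile_le_iff[OF assms(2), of p r] eq by auto
qed

text \<open>These half-open intervals tile (0,1]; having them explicitly yields both the
  measurability and the length of the level sets.\<close>

lemma quantile_eq_set:
  "{u\<in>{0<..1}. quantile p u = s} = {measure p {..<s}<..measure p {..s}}"
proof -
  have "0 \<le> measure p {..<s}" "measure p {..s} \<le> 1" by auto
  then have "u \<in> {0<..1}" if "u \<in> {measure p {..<s}<..measure p {..s}}" for u
    using that by (auto simp del: measure_nonneg measure_pmf.prob_le_1)
  moreover have "quantile p u = s \<longleftrightarrow> quantile p u \<le> s \<and> \<not> quantile p u < s" for u
    by auto
  ultimately show ?thesis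
    by (auto simp: quantile_le_iff quantile_less_iff not_le)
qed

lemma measure_quantile_eq: "measure lborel {u\<in>{0<..1}. quantile p u = s} = pmf p s"
proof -
  have "{..s} = insert s {..<s}" by auto
  then have "measure p {..s} = pmf p s + measure p {..<s}"
    using measure_pmf.finite_measure_Union[of "{s}" p "{..<s}"] by (simp add: measure_pmf_single)
  then show ?thesis unfolding quantile_eq_set by simp
qed

text \<open>The larger law has the smaller distribution function: at \<open>quantile q u\<close> the
  function of \<open>q\<close> has reached \<open>u\<close>, hence so has that of
  \<open>p\<close>.\<close>

lemma quantile_mono:
  fixes p q :: "'s::{finite,linorder} pmf"
  assumes "\<And>s. measure q {..s} \<le> measure p {..s}" "u \<le> 1"
  shows "quantile p u \<le> quantile q u"
  using assms order_trans[OF _ assms(1)] quantile_le_iff[OF assms(2), of q "quantile q u"]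
  by (auto simp: quantile_le_iff)

section \<open>Coupling finitely many laws through one uniform variable\<close>

text \<open>This is the joint law of the numbers \<open>quantile (p i) U\<close> for a single U
  uniform on (0,1], given by its mass function because tuples form a finite type.\<close>

definition quantile_coupling :: "('n::finite \<Rightarrow> 's::{finite,linorder} pmf) \<Rightarrow> ('n \<Rightarrow> 's) pmf" where
  "quantile_coupling p =
     embed_pmf (\<lambda>t. measure lborel {u\<in>{0<..1}. (\<lambda>i. quantile (p i) u) = t})"

text \<open>Distinct outcomes have disjoint level sets, so lengths add up. Taking
  \<open>T = UNIV\<close> gives total mass one, and fixing one coordinate gives the
  marginals.\<close>

lemma sum_measure_quantile:
  fixes p :: "'n::finite \<Rightarrow> 's::{finite,linorder} pmf"
  shows "(\<Sum>t\<in>T. measure lborel {u\<in>{0<..1}. (\<lambda>i. quantile (p i) u) = t}) =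
    measure lborel {u\<in>{0<..1}. (\<lambda>i. quantile (p i) u) \<in> T}"
proof -
  define A where "A t = {u\<in>{0<..1}. (\<lambda>i. quantile (p i) u) = t}" for t
  \<comment> \<open>A level set of the tuple is a finite intersection of intervals, hence
    Borel.\<close>
  have "A t = {0<..1} \<inter> (\<Inter>i. {measure (p i) {..<t i}<..measure (p i) {..t i}})" for t
    unfolding A_def quantile_eq_set[symmetric] by (auto simp: fun_eq_iff)
  then have meas: "A t \<in> sets lborel" for t by simp
  have "emeasure lborel (A t) \<le> emeasure lborel {0<..1::real}" for t
    by (rule emeasure_mono) (auto simp: A_def)
  then have fin: "emeasure lborel (A t) \<noteq> \<infinity>" for t
    by (metis emeasure_lborel_Ioc ennreal_neq_top infinity_ennreal_def top_unique zero_le_one)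
  have "(\<Sum>t\<in>T. measure lborel (A t)) = measure lborel (\<Union>t\<in>T. A t)"
    by (rule measure_finite_Union[symmetric])
      (use meas fin in \<open>auto simp: disjoint_family_on_def A_def\<close>)
  also have "(\<Union>t\<in>T. A t) = {u\<in>{0<..1}. (\<lambda>i. quantile (p i) u) \<in> T}"
    by (auto simp: A_def)
  finally show ?thesis unfolding A_def .
qed

lemma pmf_quantile_coupling:
  "pmf (quantile_coupling p) t = measure lborel {u\<in>{0<..1}. (\<lambda>i. quantile (p i) u) = t}"
  unfolding quantile_coupling_def
proof (rule pmf_embed_pmf)
  have "{u. 0 < u \<and> u \<le> 1} = {0<..1::real}" by auto
  then show "(\<integral>\<^sup>+ t. ennreal (measure lborel {u\<in>{0<..1}. (\<lambda>i. quantile (p i) u) = t}) \<partial>count_space UNIV) = 1"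
    using sum_measure_quantile[of p UNIV]
    by (simp add: nn_integral_count_space_finite sum_ennreal)
qed simp

lemma quantile_coupling_marginal:
  "(\<Sum>t | t i = s. pmf (quantile_coupling p) t) = pmf (p i) s"
  unfolding pmf_quantile_coupling sum_measure_quantile measure_quantile_eq[symmetric] by simp

text \<open>An outcome of positive mass has a nonempty level set, so it is the vector of quantiles
  at one common \<open>u\<close>, where \<open>quantile_mono\<close> applies.\<close>

lemma mono_quantile_coupling:
  fixes p :: "'n::{finite,linorder} \<Rightarrow> 's::{finite,linorder} pmf"
  assumes "\<And>i j s. i \<le> j \<Longrightarrow> measure (p j) {..s} \<le> measure (p i) {..s}"
    and "t \<in> set_pmf (quantile_coupling p)"
  shows "mono t"
proof -
  have "{u\<in>{0<..1}. (\<lambda>i. quantile (p i) u) = t} \<noteq> {}"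
    using assms(2) unfolding set_pmf_iff pmf_quantile_coupling by (auto simp del: Collect_empty_eq)
  then obtain u where u: "u \<le> 1" "t = (\<lambda>i. quantile (p i) u)" by auto
  show ?thesis unfolding u(2) by (intro monoI quantile_mono assms(1) u(1))
qed

section \<open>Product kernels on configurations and their measurability\<close>

lemma space_config_space [simp]: "space config_space = UNIV"
  by (simp add: config_space_def space_PiM)

lemma sets_pca_kernel [simp, measurable_cong]: "sets (pca_kernel p \<eta>) = sets config_space"
  unfolding pca_kernel_def config_space_def by (intro sets_PiM_cong) auto

lemma space_pca_kernel [simp]: "space (pca_kernel p \<eta>) = UNIV"
  using sets_eq_imp_space_eq[OF sets_pca_kernel] by simp

lemma prob_space_pca_kernel: "prob_space (pca_kernel p \<eta>)"
  unfolding pca_kernel_def by (intro prob_space_PiM measure_pmf.prob_space_axioms)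

lemma measurable_component_config [measurable]:
  "(\<lambda>\<omega>. \<omega> k) \<in> config_space \<rightarrow>\<^sub>M count_space UNIV"
  unfolding config_space_def by measurable

lemma emeasure_pca_kernel_cylinder:
  assumes "finite J"
  shows "emeasure (pca_kernel p \<eta>) {\<omega>. \<forall>j\<in>J. \<omega> j \<in> X j} = (\<Prod>j\<in>J. emeasure (p j \<eta>) (X j))"
proof -
  interpret product_prob_space "\<lambda>k. measure_pmf (p k \<eta>)" UNIV
    by unfold_locales
  show ?thesis
    using emeasure_PiM_Collect[of J X] assms by (simp add: pca_kernel_def space_PiM)
qed

lemma AE_pca_kernel_component:
  assumes "\<And>t. t \<in> set_pmf (p k \<eta>) \<Longrightarrow> R t"
  shows "AE \<omega> in pca_kernel p \<eta>. R (\<omega> k)"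
  unfolding pca_kernel_def
  by (rule AE_PiM_component) (auto intro: measure_pmf.prob_space_axioms simp: AE_measure_pmf_iff assms)

text \<open>Only finitely many patterns on \<open>V\<close> exist, so every preimage is a finite
  union of cylinders.\<close>

lemma measurable_local:
  fixes f :: "('d::finite, 's::finite) config \<Rightarrow> 'a"
  assumes V: "finite V" "\<And>\<eta> \<eta>'. (\<forall>j\<in>V. \<eta> j = \<eta>' j) \<Longrightarrow> f \<eta> = f \<eta>'"
  shows "f \<in> config_space \<rightarrow>\<^sub>M count_space UNIV"
proof (rule measurableI)
  fix A
  let ?E = "PiE V (\<lambda>_. UNIV :: 's set)"
  have "f -` A = (\<Union>a\<in>{a\<in>?E. f a \<in> A}. {\<eta>. \<forall>j\<in>V. \<eta> j = a j})"
  proof safe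
    fix \<eta> assume "f \<eta> \<in> A"
    \<comment> \<open>The restriction, \<open>undefined\<close> off \<open>V\<close>, is the
      representative of the pattern of \<eta> on \<open>V\<close>; locality makes \<open>f\<close>
      blind to the change.\<close>
    moreover have "f (restrict \<eta> V) = f \<eta>" by (rule V(2)) auto
    ultimately show "\<eta> \<in> (\<Union>a\<in>{a\<in>?E. f a \<in> A}. {\<eta>. \<forall>j\<in>V. \<eta> j = a j})"
      by (auto intro!: exI[of _ "restrict \<eta> V"])
  next
    fix \<eta> a assume "f a \<in> A" "\<forall>j\<in>V. \<eta> j = a j"
    then show "\<eta> \<in> f -` A" using V(2)[of \<eta> a] by simp
  qed
  moreover have "finite {a\<in>?E. f a \<in> A}" using V(1) by (intro finite_subset[OF _ finite_PiE]) auto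
  moreover have "{\<eta>. \<forall>j\<in>V. \<eta> j = a j} \<in> sets config_space" for a :: "('d, 's) config"
  proof -
    have "{\<eta>\<in>space config_space. \<forall>j\<in>V. \<eta> j = a j} \<in> sets config_space"
      using V(1) by measurable
    then show ?thesis by simp
  qed
  ultimately have "f -` A \<in> sets config_space" by auto
  then show "f -` A \<inter> space config_space \<in> sets config_space" by simp
qed simp

text \<open>This is what lets the kernel be composed by bind in \<open>pca_law\<close>. It suffices
  to test cylinders, which form an intersection-stable generator; there the mass is a finite product
  of local probabilities, each measurable by locality.\<close>

lemma measurable_pca_kernel:
  fixes p :: "('d::finite, 's::finite) local_kernels"
  assumes "is_pca p"
  shows "pca_kernel p \<in> config_space \<rightarrow>\<^sub>M prob_algebra config_space"
proof (rule measurable_prob_algebra_generated)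
  let ?G = "prod_algebra (UNIV :: (int ^ 'd) set) (\<lambda>_. count_space (UNIV :: 's set))"
  show "sets config_space = sigma_sets UNIV ?G"
    unfolding config_space_def sets_PiM by simp
  show "Int_stable ?G" by (rule Int_stable_prod_algebra)
  fix A assume "A \<in> ?G"
  then obtain J X where A: "A = prod_emb UNIV (\<lambda>_. count_space UNIV) J (Pi\<^sub>E J X)" and J: "finite J"
    by (rule prod_algebraE)
  have A: "A = {\<omega>. \<forall>j\<in>J. \<omega> j \<in> X j}"
    unfolding A by (auto simp: prod_emb_def)
  have "(\<lambda>\<eta>. emeasure (p j \<eta>) (X j)) \<in> borel_measurable config_space" for j
  proof -
    obtain V where "finite V" "\<And>\<eta> \<eta>'. (\<forall>j\<in>V. \<eta> j = \<eta>' j) \<Longrightarrow> p j \<eta> = p j \<eta>'"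
      using assms unfolding is_pca_def by blast
    then have "p j \<in> config_space \<rightarrow>\<^sub>M count_space UNIV" by (rule measurable_local)
    from measurable_compose[OF this, of "\<lambda>q. emeasure q (X j)" borel] show ?thesis by simp
  qed
  then show "(\<lambda>\<eta>. emeasure (pca_kernel p \<eta>) A) \<in> borel_measurable config_space"
    unfolding A emeasure_pca_kernel_cylinder[OF J] by measurable
qed (auto intro: prob_space_pca_kernel)

lemma pca_law_in_prob_algebra:
  fixes p :: "('d::finite, 's::finite) local_kernels"
  assumes "is_pca p"
  shows "pca_law p n \<eta> \<in> space (prob_algebra config_space)"
proof (induction n)
  case 0
  show ?case by (simp add: space_prob_algebra prob_space_return)
next
  case (Suc n)
  then show ?case
    using prob_space_bind'[OF Suc measurable_pca_kernel[OF assms]]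
      sets_bind'[OF Suc measurable_pca_kernel[OF assms]]
    by (simp add: space_prob_algebra)
qed

section \<open>Ordered tuples and the marginals of a coupled kernel\<close>

text \<open>Being ordered becomes a countable conjunction of one-site conditions, which gives its
  measurability and reduces almost sure order to single sites.\<close>

lemma mono_split_iff: "mono (split_config \<omega>) \<longleftrightarrow> (\<forall>k. mono (\<omega> k))"
  by (auto simp: mono_def split_config_def le_fun_def)

lemma split_join [simp]: "split_config (join_configs \<zeta>) = \<zeta>"
  by (simp add: split_config_def join_configs_def)

lemma pred_mono_split [measurable]:
  "Measurable.pred (config_space :: ('d::finite, 'n::{finite,linorder} \<Rightarrow> 's::{finite,order}) config measure)
     (\<lambda>\<omega>. mono (split_config \<omega>))"
  unfolding mono_split_iff by measurable

lemma measurable_split_config [measurable]: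
  "(\<lambda>\<omega>. split_config \<omega> i) \<in> config_space \<rightarrow>\<^sub>M config_space"
proof -
  have "(\<lambda>\<omega>. \<omega> k i) \<in> config_space \<rightarrow>\<^sub>M count_space UNIV" for k
    by (rule measurable_compose[OF measurable_component_config]) simp
  then have "(\<lambda>\<omega> k. \<omega> k i) \<in> config_space \<rightarrow>\<^sub>M (\<Pi>\<^sub>M k\<in>UNIV. count_space UNIV)"
    by (intro measurable_PiM_single') auto
  then show ?thesis
    by (simp add: split_config_def config_space_def)
qed

text \<open>A product measure is determined by its values on cylinders. The preimage of a cylinder
  under projection to component \<open>i\<close> is again a cylinder, so equality of the one-site
  marginals is enough.\<close>

lemma distr_pca_kernel_coupling:
  fixes P :: "'n::finite \<Rightarrow> ('d::finite, 's::finite) local_kernels"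
  assumes "synchronous_coupling P Q"
  shows "distr (pca_kernel Q (join_configs \<zeta>)) config_space (\<lambda>\<omega>. split_config \<omega> i) =
    pca_kernel (P i) (\<zeta> i)"
proof -
  let ?Q = "pca_kernel Q (join_configs \<zeta>)"
  interpret product_prob_space "\<lambda>k. measure_pmf (P i k (\<zeta> i))" UNIV
    by unfold_locales
  have marg: "emeasure (Q k (join_configs \<zeta>)) {t. t i \<in> X} = emeasure (P i k (\<zeta> i)) X" for k X
  proof -
    have "map_pmf (\<lambda>t. t i) (Q k (join_configs \<zeta>)) = P i k (\<zeta> i)"
    proof (rule pmf_eqI)
      fix s
      have "pmf (map_pmf (\<lambda>t. t i) (Q k (join_configs \<zeta>))) s =
          measure (Q k (join_configs \<zeta>)) {t. t i = s}"
        by (simp add: pmf_map vimage_def)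
      also have "\<dots> = (\<Sum>t | t i = s. pmf (Q k (join_configs \<zeta>)) t)"
        by (rule measure_measure_pmf_finite) simp
      finally show "pmf (map_pmf (\<lambda>t. t i) (Q k (join_configs \<zeta>))) s = pmf (P i k (\<zeta> i)) s"
        using assms by (simp add: synchronous_coupling_def)
    qed
    then have "emeasure (P i k (\<zeta> i)) X = emeasure (map_pmf (\<lambda>t. t i) (Q k (join_configs \<zeta>))) X"
      by simp
    then show ?thesis by (simp add: vimage_def)
  qed
  have split_meas: "(\<lambda>\<omega>. split_config \<omega> i) \<in> ?Q \<rightarrow>\<^sub>M config_space"
    by measurable
  show ?thesis
    unfolding pca_kernel_def[of "P i"]
  proof (rule PiM_eq)
    show "sets (distr ?Q config_space (\<lambda>\<omega>. split_config \<omega> i)) =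
        sets (\<Pi>\<^sub>M k\<in>UNIV. measure_pmf (P i k (\<zeta> i)))"
      using sets_pca_kernel[of "P i" "\<zeta> i"] by (simp add: pca_kernel_def)
    fix J :: "(int ^ 'd) set" and F assume J: "finite J"
    let ?E = "prod_emb UNIV (\<lambda>k. measure_pmf (P i k (\<zeta> i))) J (Pi\<^sub>E J F)"
    have E: "?E = {\<omega>. \<forall>j\<in>J. \<omega> j \<in> F j}" by (auto simp: prod_emb_def)
    have "?E \<in> sets (pca_kernel (P i) (\<zeta> i))"
      unfolding pca_kernel_def by (rule sets_PiM_I) (use J in auto)
    then have "emeasure (distr ?Q config_space (\<lambda>\<omega>. split_config \<omega> i)) ?E =
        emeasure ?Q {\<omega>. \<forall>j\<in>J. \<omega> j \<in> {t. t i \<in> F j}}"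
      unfolding E by (subst emeasure_distr[OF split_meas]) (auto simp: vimage_def split_config_def)
    then show "emeasure (distr ?Q config_space (\<lambda>\<omega>. split_config \<omega> i)) ?E =
        (\<Prod>j\<in>J. emeasure (P i j (\<zeta> i)) (F j))"
      unfolding emeasure_pca_kernel_cylinder[OF J] marg .
  qed
qed

section \<open>An increasing coupling forces the tuple to be increasing\<close>

lemma increasing_tuple_if_coupling:
  fixes P :: "'n::{finite,linorder} \<Rightarrow> ('d::finite, 's::{finite,linorder}) local_kernels"
  assumes "increasing_synchronous_coupling P Q"
  shows "increasing_tuple P"
  unfolding increasing_tuple_def stoch_le_def
proof (intro allI impI conjI)
  fix \<zeta> :: "'n \<Rightarrow> ('d, 's) config" and i j :: 'n and f :: "('d, 's) config \<Rightarrow> real"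
  assume \<zeta>: "mono \<zeta>" and ij: "i \<le> j" and f: "bounded (range f)" "mono f"
    and "f \<in> borel_measurable (pca_kernel (P i) (\<zeta> i))"
  then have fm [measurable]: "f \<in> borel_measurable config_space"
    by (simp cong: measurable_cong_sets)
  have Q: "synchronous_coupling P Q" "is_pca Q"
    using assms by (auto simp: increasing_synchronous_coupling_def synchronous_coupling_def)
  let ?Q = "pca_kernel Q (join_configs \<zeta>)"
  interpret prob_space ?Q by (rule prob_space_pca_kernel)
  have "pca_law Q 1 (join_configs \<zeta>) = ?Q"
    using bind_return[OF measurable_prob_algebraD[OF measurable_pca_kernel[OF Q(2)]]] by simp
  then have "measure ?Q {\<omega>. mono (split_config \<omega>)} = 1"
    using assms \<zeta> unfolding increasing_synchronous_coupling_def
    by (metis le_refl)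
  moreover have "{\<omega>. mono (split_config \<omega>)} \<in> sets ?Q"
    using pred_mono_split[unfolded pred_def] by simp
  ultimately have mono: "AE \<omega> in ?Q. mono (split_config \<omega>)"
    using AE_in_set_eq_1 by fastforce
  have sm: "(\<lambda>\<omega>. split_config \<omega> l) \<in> ?Q \<rightarrow>\<^sub>M config_space" for l
    by measurable
  have int: "integrable ?Q (\<lambda>\<omega>. f (split_config \<omega> l))" for l
  proof -
    obtain B where "\<And>x. norm (f x) \<le> B" using f(1) by (auto simp: bounded_iff)
    then show ?thesis
      by (intro integrable_const_bound[of _ B] measurable_compose[OF sm fm]) auto
  qed
  \<comment> \<open>Both expectations become integrals over the same coupled space, where the
    integrands are ordered almost surely.\<close>
  have eq: "integral\<^sup>L (pca_kernel (P l) (\<zeta> l)) f = (\<integral>\<omega>. f (split_config \<omega> l) \<partial>?Q)" for l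
    unfolding distr_pca_kernel_coupling[OF Q(1), symmetric] by (rule integral_distr[OF sm fm])
  show "integral\<^sup>L (pca_kernel (P i) (\<zeta> i)) f \<le> integral\<^sup>L (pca_kernel (P j) (\<zeta> j)) f"
    unfolding eq
    by (rule integral_mono_AE[OF int int]) (use mono ij f(2) in \<open>auto elim!: eventually_mono dest: monoD\<close>)
qed simp

section \<open>The quantile coupling of an increasing tuple\<close>

text \<open>Test the stochastic order with the increasing function that indicates a spin above
  \<open>s\<close> at site \<open>k\<close>: its expectation is one minus the local distribution
  function at \<open>s\<close>, which reverses the inequality.\<close>

lemma increasing_tuple_cdf:
  fixes P :: "'n::{finite,linorder} \<Rightarrow> ('d::finite, 's::{finite,linorder}) local_kernels"
  assumes "increasing_tuple P" "mono \<zeta>" "i \<le> j"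
  shows "measure (P j k (\<zeta> j)) {..s} \<le> measure (P i k (\<zeta> i)) {..s}"
proof -
  define f :: "('d, 's) config \<Rightarrow> real" where "f = (\<lambda>\<omega>. indicator {s<..} (\<omega> k))"
  have fm: "f \<in> borel_measurable config_space" unfolding f_def by measurable
  have "mono f"
    by (auto simp: mono_def f_def le_fun_def indicator_def intro: less_le_trans)
  moreover have "bounded (range f)"
    by (rule boundedI[of _ 1]) (auto simp: f_def indicator_def)
  moreover have "f \<in> borel_measurable (pca_kernel (P i) (\<zeta> i))"
    using fm by (simp cong: measurable_cong_sets)
  ultimately have "integral\<^sup>L (pca_kernel (P i) (\<zeta> i)) f \<le> integral\<^sup>L (pca_kernel (P j) (\<zeta> j)) f"
    using assms unfolding increasing_tuple_def stoch_le_def by blast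
  moreover have "integral\<^sup>L (pca_kernel p \<eta>) f = 1 - measure (p k \<eta>) {..s}"
    for p :: "('d, 's) local_kernels" and \<eta>
  proof -
    interpret prob_space "pca_kernel p \<eta>" by (rule prob_space_pca_kernel)
    have ms: "{\<omega>. \<omega> k \<in> {s<..}} \<in> sets (pca_kernel p \<eta>)"
      using measurable_sets[OF measurable_component_config, of "{s<..}" k] by (simp add: vimage_def)
    have "f = indicator {\<omega>. \<omega> k \<in> {s<..}}" by (auto simp: f_def indicator_def fun_eq_iff)
    then have "integral\<^sup>L (pca_kernel p \<eta>) f = measure (pca_kernel p \<eta>) {\<omega>. \<omega> k \<in> {s<..}}"
      using ms by simp
    also have "\<dots> = measure (p k \<eta>) {s<..}"
      using emeasure_pca_kernel_cylinder[of "{k}" p \<eta> "\<lambda>_. {s<..}"] by (simp add: measure_def)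
    also have "{s<..} = space (p k \<eta>) - {..s}" by auto
    also have "measure (p k \<eta>) \<dots> = 1 - measure (p k \<eta>) {..s}"
      by (rule measure_pmf.prob_compl) simp
    finally show ?thesis .
  qed
  ultimately show ?thesis by simp
qed

text \<open>All \<open>N\<close> components share one uniform variable at each site; independence
  between sites comes from the product in \<open>pca_kernel\<close>.\<close>

definition coupled_kernels ::
    "('n::finite \<Rightarrow> ('d::finite, 's::{finite,linorder}) local_kernels) \<Rightarrow>
     ('d, 'n \<Rightarrow> 's) local_kernels" where
  "coupled_kernels P = (\<lambda>k \<omega>. quantile_coupling (\<lambda>i. P i k (split_config \<omega> i)))"

lemma is_pca_coupled_kernels:
  assumes "\<And>i. is_pca (P i)"
  shows "is_pca (coupled_kernels P)"
  unfolding is_pca_def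
proof
  fix k
  have "\<forall>i. \<exists>V. finite V \<and> (\<forall>\<eta> \<eta>'. (\<forall>j\<in>V. \<eta> j = \<eta>' j) \<longrightarrow> P i k \<eta> = P i k \<eta>')"
    using assms unfolding is_pca_def by blast
  then obtain V where V: "\<And>i. finite (V i)"
    "\<And>i \<eta> \<eta>'. (\<forall>j\<in>V i. \<eta> j = \<eta>' j) \<Longrightarrow> P i k \<eta> = P i k \<eta>'"
    by metis
  \<comment> \<open>The neighbourhood of \<open>k\<close> is the union of those of all components,
    finite since the index type is.\<close>
  have "coupled_kernels P k \<omega> = coupled_kernels P k \<omega>'" if "\<forall>j\<in>(\<Union>i. V i). \<omega> j = \<omega>' j" for \<omega> \<omega>'
  proof -
    have "P i k (split_config \<omega> i) = P i k (split_config \<omega>' i)" for i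
      by (rule V(2)) (use that in \<open>auto simp: split_config_def\<close>)
    then show ?thesis by (simp add: coupled_kernels_def)
  qed
  with V(1) show "\<exists>V. finite V \<and> (\<forall>\<eta> \<eta>'. (\<forall>j\<in>V. \<eta> j = \<eta>' j) \<longrightarrow>
      coupled_kernels P k \<eta> = coupled_kernels P k \<eta>')"
    by (intro exI[of _ "\<Union>i. V i"]) auto
qed

lemma synchronous_coupling_coupled_kernels:
  assumes "\<And>i. is_pca (P i)"
  shows "synchronous_coupling P (coupled_kernels P)"
  unfolding synchronous_coupling_def
  using is_pca_coupled_kernels[OF assms] by (simp add: coupled_kernels_def quantile_coupling_marginal)

text \<open>The order of the present configurations orders the local distribution functions, so each
  site is almost surely ordered; the exceptional null sets are countably many.\<close>

lemma AE_mono_coupled_kernels: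
  fixes P :: "'n::{finite,linorder} \<Rightarrow> ('d::finite, 's::{finite,linorder}) local_kernels"
  assumes "increasing_tuple P" "mono (split_config \<omega>)"
  shows "AE \<omega>' in pca_kernel (coupled_kernels P) \<omega>. mono (split_config \<omega>')"
  unfolding mono_split_iff AE_all_countable
proof
  fix k
  show "AE \<omega>' in pca_kernel (coupled_kernels P) \<omega>. mono (\<omega>' k)"
    by (rule AE_pca_kernel_component)
      (auto simp: coupled_kernels_def intro: mono_quantile_coupling[rotated] increasing_tuple_cdf[OF assms])
qed

lemma increasing_coupled_kernels:
  fixes P :: "'n::{finite,linorder} \<Rightarrow> ('d::finite, 's::{finite,linorder}) local_kernels"
  assumes "\<And>i. is_pca (P i)" "increasing_tuple P"
  shows "increasing_synchronous_coupling P (coupled_kernels P)"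
  unfolding increasing_synchronous_coupling_def
proof (intro conjI allI impI synchronous_coupling_coupled_kernels assms(1))
  fix \<sigma> :: "'n \<Rightarrow> ('d, 's) config" and n :: nat
  assume \<sigma>: "mono \<sigma>"
  let ?Q = "coupled_kernels P"
  let ?L = "\<lambda>n. pca_law ?Q n (join_configs \<sigma>)"
  have pca: "is_pca ?Q" by (rule is_pca_coupled_kernels[OF assms(1)])
  have law: "prob_space (?L n)" "sets (?L n) = sets config_space" for n
    using pca_law_in_prob_algebra[OF pca, of n "join_configs \<sigma>"] by (auto simp: space_prob_algebra)
  \<comment> \<open>Induction starts at time 0, where the law is a point mass at the ordered initial
    tuple; each further step preserves the order almost surely.\<close>
  have ae: "AE \<omega> in ?L n. mono (split_config \<omega>)"
  proof (induction n)
    case 0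
    show ?case
      unfolding pca_law.simps using \<sigma> AE_return[OF _ pred_mono_split, of "join_configs \<sigma>"] by simp
  next
    case (Suc n)
    have "pca_kernel ?Q \<in> ?L n \<rightarrow>\<^sub>M subprob_algebra config_space"
      using measurable_prob_algebraD[OF measurable_pca_kernel[OF pca]] law(2)[of n]
      by (simp cong: measurable_cong_sets)
    from AE_bind[OF this pred_mono_split] Suc show ?case
      unfolding pca_law.simps
      by (auto elim!: eventually_mono intro: AE_mono_coupled_kernels[OF assms(2)])
  qed
  interpret prob_space "?L n" by (rule law)
  have "{\<omega>. mono (split_config \<omega>)} \<in> sets (?L n)"
    using pred_mono_split[unfolded pred_def] law(2) by simp
  with ae show "measure (?L n) {\<omega>. mono (split_config \<omega>)} = 1"
    using AE_in_set_eq_1 by fastforce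
qed

theorem theorem2p4:
  fixes P :: "'n::{finite,linorder} \<Rightarrow> ('d::finite, 's::{finite,linorder}) local_kernels"
  assumes "CARD('n) \<ge> 2"
    and "\<And>i. is_pca (P i)"
  shows "(\<exists>Q. increasing_synchronous_coupling P Q) \<longleftrightarrow> increasing_tuple P"
  using increasing_tuple_if_coupling increasing_coupled_kernels[of P, OF assms(2)] by blast

end
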